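(* Let $n,m\in\mathbb N$ with $m\ge n$, let $\Omega\subset\mathbb R^n$ be open, let $A$ be a Young function satisfying (C1), (C2), (C3), and let $B$ be the associated function. Let $u\in V^{1,A}(\Omega,\mathbb R^m)$. Then $$\mathscr H^n_\infty(u(E))\le 2\kappa^{n+1}\|\nabla u\|^n_{L^A(\Omega)}\,\Phi_B\big(\mathscr L^n(E)\,n^{n/2}/\kappa\big)$$ for every set $E\subset\Omega$, where $\mathscr L^n$ is the outer Lebesgue measure and $\Phi_B(0)=0$, $\Phi_B(r)=r\,\big(B^{-1}(1/r)\big)^n$ for $r>0$.
   Context: $\mathscr H^n_\infty$ denotes the $n$-dimensional Hausdorff content in $\mathbb R^m$: $\mathscr H^n_\infty(F)=\inf\{\sum_i d(F_i)^n: F\subset\bigcup_iF_i\}$, $d$ = diameter. A Young function is a non-trivial convex $A\colon[0,\infty)\to[0,\infty]$ with $A(0)=0$; $\widetilde A(t)=\sup_{\tau\ge0}(\tau t-A(\tau))$. $\|f\|_{L^A(\Omega)}=\inf\{\lambda>0:\int_\Omega A(|f|/\lambda)dx\le1\}$. $V^{1,A}(\Omega,\mathbb R^m)=\{u\in L^1_{\rm loc}(\Omega,\mathbb R^m)$ weakly differentiable, $|\nabla u|\in L^A(\Omega)\}$. Conditions: (C1) if $n=1$, $\lim_{t\to\infty}t/A(t)=0$; if $n\ge2$, $\int^\infty (t/A(t))^{1/(n-1)}dt<\infty$. (C2) $0<A(t)<\infty$ for $t>0$. (C3) if $n=1$, $\lim_{t\to0^+}t/A(t)=\infty$; if $n\ge2$,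 $\int_0(t/A(t))^{1/(n-1)}dt=\infty$. The continuous representative of $u$ is used. $B=A$ if $n=1$; for $n\ge2$, $B$ is the Young conjugate of $t\mapsto t^{n'}\int_t^\infty\widetilde A(s)s^{-1-n'}ds$, $n'=n/(n-1)$. $\kappa=\kappa(n,m)$ is a constant such that for every $u\in V^{1,A}(\Omega,\mathbb R^m)$, every open cube $Q\subset\Omega$ and every $\lambda>0$ making the integral finite, $\frac{d(Q)^n}{\kappa}B\big(\frac{d(u(Q))}{\kappa\lambda d(Q)}\big)\le\int_QA(|\nabla u|/\lambda)dx$. *)

theory Defs
  imports "HOL-Analysis.Analysis"
begin

text \<open>Extended diameter (infinite for unbounded sets, 0 for the empty set).\<close>
definition ediam :: "'a::metric_space set \<Rightarrow> ennreal" where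
  "ediam S = (SUP x\<in>S. SUP y\<in>S. ennreal (dist x y))"

definition hcontent :: "nat \<Rightarrow> 'a::metric_space set \<Rightarrow> ennreal" where
  "hcontent n F = (INF C\<in>{C::nat \<Rightarrow> 'a set. F \<subseteq> (\<Union>i. C i)}. \<Sum>i. ediam (C i) ^ n)"

definition louter :: "'a::euclidean_space set \<Rightarrow> ennreal" where
  "louter E = (INF M\<in>{M. M \<in> sets lebesgue \<and> E \<subseteq> M}. emeasure lebesgue M)"

text \<open>Young functions are represented as real-valued functions on [0,inf);
  this is harmless here because condition (C2) forces finite values.\<close>
definition young :: "(real \<Rightarrow> real) \<Rightarrow> bool" where
  "young A \<longleftrightarrow> A 0 = 0 \<and> (\<forall>t\<ge>0. A t \<ge> 0) \<and> convex_on {0..} A \<and> (\<exists>t>0. A t \<noteq> 0)"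

definition young_conj :: "(real \<Rightarrow> real) \<Rightarrow> real \<Rightarrow> ereal" where
  "young_conj A t = (SUP \<tau>\<in>{0..}. ereal (\<tau> * t - A \<tau>))"

definition cond_C1 :: "nat \<Rightarrow> (real \<Rightarrow> real) \<Rightarrow> bool" where
  "cond_C1 n A \<longleftrightarrow>
     (if n = 1 then ((\<lambda>t. t / A t) \<longlongrightarrow> 0) at_top
      else (\<exists>t0>0. (\<integral>\<^sup>+ t\<in>{t0..}. ennreal ((t / A t) powr (1 / (real n - 1))) \<partial>lborel) < \<infinity>))"

definition cond_C2 :: "(real \<Rightarrow> real) \<Rightarrow> bool" where
  "cond_C2 A \<longleftrightarrow> (\<forall>t>0. 0 < A t)"

definition cond_C3 :: "nat \<Rightarrow> (real \<Rightarrow> real) \<Rightarrow> bool" where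
  "cond_C3 n A \<longleftrightarrow>
     (if n = 1 then filterlim (\<lambda>t. t / A t) at_top (at_right 0)
      else (\<forall>t0>0. (\<integral>\<^sup>+ t\<in>{0<..<t0}. ennreal ((t / A t) powr (1 / (real n - 1))) \<partial>lborel) = \<infinity>))"

definition E_fun :: "nat \<Rightarrow> (real \<Rightarrow> real) \<Rightarrow> real \<Rightarrow> ereal" where
  "E_fun n A t = (let n' = real n / (real n - 1) in
     enn2ereal (ennreal (t powr n') *
       (\<integral>\<^sup>+ s\<in>{t<..}. e2ennreal (young_conj A s) * ennreal (s powr (-1 - n')) \<partial>lborel)))"

definition young_conj_e :: "(real \<Rightarrow> ereal) \<Rightarrow> real \<Rightarrow> ereal" where
  "young_conj_e F t = (SUP \<tau>\<in>{0..}. ereal (\<tau> * t) - F \<tau>)"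

definition B_fun :: "nat \<Rightarrow> (real \<Rightarrow> real) \<Rightarrow> real \<Rightarrow> ereal" where
  "B_fun n A = (if n = 1 then (\<lambda>t. ereal (A t)) else young_conj_e (E_fun n A))"

definition inv_fun :: "(real \<Rightarrow> ereal) \<Rightarrow> real \<Rightarrow> ereal" where
  "inv_fun B s = (SUP t\<in>{t. t \<ge> 0 \<and> B t \<le> ereal s}. ereal t)"

definition Phi :: "nat \<Rightarrow> (real \<Rightarrow> ereal) \<Rightarrow> ennreal \<Rightarrow> ennreal" where
  "Phi n B r = (if r = 0 then 0 else if r = \<infinity> then \<infinity>
      else r * e2ennreal (inv_fun B (1 / enn2real r)) ^ n)"

definition orlicz_int :: "(real \<Rightarrow> real) \<Rightarrow> 'a::euclidean_space set \<Rightarrow> ('a \<Rightarrow> real) \<Rightarrow> real \<Rightarrow> ennreal" where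
  "orlicz_int A \<Omega> f l = (\<integral>\<^sup>+ x\<in>\<Omega>. ennreal (A (\<bar>f x\<bar> / l)) \<partial>lebesgue)"

definition lux_norm :: "(real \<Rightarrow> real) \<Rightarrow> 'a::euclidean_space set \<Rightarrow> ('a \<Rightarrow> real) \<Rightarrow> ennreal" where
  "lux_norm A \<Omega> f = (INF l\<in>{l. l > 0 \<and> orlicz_int A \<Omega> f l \<le> 1}. ennreal l)"

definition in_orlicz :: "(real \<Rightarrow> real) \<Rightarrow> 'a::euclidean_space set \<Rightarrow> ('a \<Rightarrow> real) \<Rightarrow> bool" where
  "in_orlicz A \<Omega> f \<longleftrightarrow> f \<in> borel_measurable (lebesgue_on \<Omega>) \<and> (\<exists>l>0. orlicz_int A \<Omega> f l < \<infinity>)"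

fun Ck :: "nat \<Rightarrow> (real^'n \<Rightarrow> real) \<Rightarrow> bool" where
  "Ck 0 f = continuous_on UNIV f"
| "Ck (Suc k) f = ((\<forall>x. f differentiable (at x)) \<and>
      (\<forall>j. Ck k (\<lambda>x. frechet_derivative f (at x) (axis j 1))))"

definition smooth :: "(real^'n \<Rightarrow> real) \<Rightarrow> bool" where
  "smooth f \<longleftrightarrow> (\<forall>k. Ck k f)"

definition test_fun :: "(real^'n) set \<Rightarrow> (real^'n \<Rightarrow> real) \<Rightarrow> bool" where
  "test_fun \<Omega> \<phi> \<longleftrightarrow> smooth \<phi> \<and> compact (closure {x. \<phi> x \<noteq> 0}) \<and> closure {x. \<phi> x \<noteq> 0} \<subseteq> \<Omega>"

definition loc_integrable :: "(real^'n) set \<Rightarrow> (real^'n \<Rightarrow> 'b::euclidean_space) \<Rightarrow> bool" where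
  "loc_integrable \<Omega> f \<longleftrightarrow> (\<forall>K. compact K \<and> K \<subseteq> \<Omega> \<longrightarrow> set_integrable lebesgue K f)"

text \<open>G is a weak gradient (Jacobian, G x $ i $ j = d_j u_i) of u in \<Omega>.\<close>
definition weak_grad :: "(real^'n) set \<Rightarrow> (real^'n \<Rightarrow> real^'m) \<Rightarrow> (real^'n \<Rightarrow> real^'n^'m) \<Rightarrow> bool" where
  "weak_grad \<Omega> u G \<longleftrightarrow> loc_integrable \<Omega> u \<and> loc_integrable \<Omega> G \<and>
     (\<forall>\<phi> i j. test_fun \<Omega> \<phi> \<longrightarrow>
        (LINT x|lebesgue. u x $ i * frechet_derivative \<phi> (at x) (axis j 1))
          = - (LINT x|lebesgue. G x $ i $ j * \<phi> x))"

text \<open>u \<in> V^{1,A}(\<Omega>) with weak gradient G (the continuous representative of u is used).\<close>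
definition V1A :: "(real \<Rightarrow> real) \<Rightarrow> (real^'n) set \<Rightarrow> (real^'n \<Rightarrow> real^'m) \<Rightarrow> (real^'n \<Rightarrow> real^'n^'m) \<Rightarrow> bool" where
  "V1A A \<Omega> u G \<longleftrightarrow> weak_grad \<Omega> u G \<and> in_orlicz A \<Omega> (\<lambda>x. norm (G x))"

definition open_cube :: "(real^'n) set \<Rightarrow> bool" where
  "open_cube Q \<longleftrightarrow> (\<exists>a r. r > 0 \<and> Q = box a (a + r *\<^sub>R One))"

definition kappa_prop :: "real \<Rightarrow> (real \<Rightarrow> real) \<Rightarrow> (real^'n) set \<Rightarrow> (real^'n \<Rightarrow> real^'m) itself \<Rightarrow> bool" where
  "kappa_prop \<kappa> A \<Omega> _ \<longleftrightarrow>
     (\<forall>(v::real^'n \<Rightarrow> real^'m) H Q l. V1A A \<Omega> v H \<and> continuous_on \<Omega> v \<and> open_cube Q \<and> Q \<subseteq> \<Omega> \<and> l > 0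
        \<and> orlicz_int A Q (\<lambda>x. norm (H x)) l < \<infinity> \<longrightarrow>
        bounded (v ` Q) \<and>
        ereal (diameter Q ^ CARD('n) / \<kappa>) * B_fun CARD('n) A (diameter (v ` Q) / (\<kappa> * l * diameter Q))
          \<le> enn2ereal (orlicz_int A Q (\<lambda>x. norm (H x)) l))"

end

theory Submission
  imports Defs
begin

text \<open>
  Write \<open>n\<close> for the dimension, \<open>\<phi> s = (B\<^sup>-\<^sup>1 s)^n\<close> and \<open>c = n^(n/2) / \<kappa>\<close>. The function \<open>B\<close> satisfies
  \<open>B (k t) \<ge> k^n * B t\<close> for \<open>k \<ge> 1\<close>, hence \<open>\<phi> s \<le> max 1 (\<rho> s) * \<phi> (1 / \<rho>)\<close> for every \<open>\<rho> > 0\<close>.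
  Decompose an open set \<open>U\<close> with \<open>E \<subseteq> U \<subseteq> \<Omega>\<close> into nonoverlapping closed cubes \<open>Q\<close>. If \<open>l\<close> is such that
  \<open>A (|\<nabla>u| / l)\<close> has integral at most 1 over \<open>\<Omega>\<close>, then the oscillation estimate on each cube gives
  \<open>d(u(Q))^n \<le> \<kappa>^(n+1) l^n \<phi> (1 / \<rho>) (c |Q| + \<rho> * \<integral>\<^sub>Q A (|\<nabla>u| / l))\<close>, and summation over the cubes yields
  the same estimate for the content of \<open>u(E)\<close>, with \<open>U\<close> in place of \<open>Q\<close>. For \<open>0 < |E| < \<infinity>\<close> take
  \<open>\<rho> = c |E|\<close> and let \<open>U\<close> shrink to \<open>E\<close> and \<open>l\<close> to the Luxemburg norm. For null sets use instead \<open>\<rho> = 1\<close>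
  and the absolute continuity of the integral; if the norm vanishes, \<open>u\<close> is constant on every cube. Both of
  these cases need \<open>\<phi> 1 < \<infinity>\<close>, which is where (C1) enters.
\<close>

subsection \<open>Young functions and the associated function B\<close>

text \<open>Convexity on the segment from 0 to \<open>t\<close>, using \<open>A 0 = 0\<close>. It
  yields monotonicity of \<open>A\<close>, the growth of \<open>B\<close> in dimension 1 and the
  finiteness of the Luxemburg norm.\<close>

lemma young_scale_le:
  assumes "young A" "c \<ge> 1" "t \<ge> 0"
  shows "A (t / c) \<le> A t / c"
proof -
  have "convex_on {0..} A" "A 0 = 0"
    using assms by (auto simp: young_def)
  then have "A ((1 - 1 / c) *\<^sub>R 0 + (1 / c) *\<^sub>R t) \<le> (1 - 1 / c) * A 0 + (1 / c) * A t"
    using assms by (intro convex_onD) auto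
  then show ?thesis using \<open>A 0 = 0\<close> by (simp add: field_simps)
qed

lemma young_mono:
  assumes "young A" "0 \<le> s" "s \<le> t"
  shows "A s \<le> A t"
proof (cases "s = 0")
  case True
  then show ?thesis using assms by (auto simp: young_def)
next
  case False
  have "A (t / (t / s)) \<le> A t / (t / s)"
    using assms False by (intro young_scale_le) (auto simp: field_simps)
  also have "\<dots> \<le> A t"
  proof -
    have "0 \<le> A t" "s / t \<le> 1" "0 \<le> s / t"
      using assms False by (simp_all add: young_def)
    then show ?thesis using mult_left_le[of "s / t" "A t"] by simp
  qed
  finally show ?thesis using assms False by simp
qed

lemma E_fun_nonneg: "0 \<le> E_fun n A t"
  by (simp add: E_fun_def Let_def)

text \<open>The factor \<open>c ^ (n - 1)\<close> is chosen because (n - 1) n' = n, so the prefactor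
  t^n' contributes exactly \<open>c ^ n\<close>, while the tail integral can only shrink when its
  lower limit grows.\<close>

lemma E_fun_scale:
  assumes "n \<ge> 2" "c \<ge> 1" "t \<ge> 0"
  shows "E_fun n A (c ^ (n - 1) * t) \<le> ereal (c ^ n) * E_fun n A t"
proof -
  define p where "p = real n / (real n - 1)"
  define I where "I = (\<lambda>t. \<integral>\<^sup>+ s\<in>{t<..}. e2ennreal (young_conj A s) * ennreal (s powr (-1 - p)) \<partial>lborel)"
  have E: "E_fun n A t = enn2ereal (ennreal (t powr p) * I t)" for t
    by (simp add: E_fun_def p_def I_def Let_def)
  have le: "t \<le> c ^ (n - 1) * t"
    using assms by (simp add: mult_right_mono mult_le_cancel_right1)
  have "I (c ^ (n - 1) * t) \<le> I t"
    unfolding I_def using le by (intro nn_integral_mono) (auto split: split_indicator)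
  have pw: "(c ^ (n - 1) * t) powr p = c ^ n * t powr p"
  proof -
    have "(c ^ (n - 1)) powr p = (c powr real (n - 1)) powr p"
      using assms by (subst powr_realpow) auto
    also have "\<dots> = c powr real n"
      using assms by (simp add: powr_powr p_def of_nat_diff)
    also have "\<dots> = c ^ n" using assms by (simp add: powr_realpow)
    finally show ?thesis using assms by (simp add: powr_mult)
  qed
  have "E_fun n A (c ^ (n - 1) * t) \<le> enn2ereal (ennreal (c ^ n) * (ennreal (t powr p) * I t))"
    unfolding E pw using assms \<open>I _ \<le> I t\<close>
    by (auto simp: ennreal_mult mult.assoc less_eq_ennreal.rep_eq[symmetric] intro!: mult_left_mono)
  also have "\<dots> = ereal (c ^ n) * E_fun n A t"
    using assms by (simp add: E times_ennreal.rep_eq)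
  finally show ?thesis .
qed

text \<open>For \<open>n = 1\<close> this is convexity of \<open>A\<close>. Otherwise it is dual to
  \<open>E_fun_scale\<close>: a competitor \<open>\<tau>\<close> for \<open>B\<close> at
  \<open>t\<close> becomes the competitor \<open>c ^ (n - 1) * \<tau>\<close> at
  \<open>c * t\<close>, where it gains the factor \<open>c ^ n\<close>.\<close>

lemma B_fun_scale:
  assumes "young A" "n \<ge> 1" "c \<ge> 1" "t \<ge> 0"
  shows "ereal (c ^ n) * B_fun n A t \<le> B_fun n A (c * t)"
proof (cases "n = 1")
  case True
  have "A (c * t / c) \<le> A (c * t) / c"
    using assms by (intro young_scale_le) auto
  then show ?thesis using True assms by (simp add: B_fun_def field_simps)
next
  case False
  then have n: "n \<ge> 2" using assms by auto
  have cn: "c ^ n > 0" using assms by simp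
  have "ereal (c ^ n) * (ereal (\<tau> * t) - E_fun n A \<tau>) \<le> young_conj_e (E_fun n A) (c * t)"
    if "\<tau> \<ge> 0" for \<tau>
  proof -
    define \<sigma> where "\<sigma> = c ^ (n - 1) * \<tau>"
    have s: "\<sigma> \<ge> 0" using that assms by (simp add: \<sigma>_def)
    have "c ^ n = c * c ^ (n - 1)"
      using n by (cases n) auto
    then have eq: "\<sigma> * (c * t) = c ^ n * (\<tau> * t)"
      by (simp add: \<sigma>_def mult_ac)
    have sc: "E_fun n A \<sigma> \<le> ereal (c ^ n) * E_fun n A \<tau>"
      using n assms that unfolding \<sigma>_def by (intro E_fun_scale) auto
    have "ereal (c ^ n) * (ereal (\<tau> * t) - E_fun n A \<tau>) \<le> ereal (\<sigma> * (c * t)) - E_fun n A \<sigma>"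
    \<comment> \<open>An infinite \<open>E_fun n A \<tau>\<close> makes the left side minus
      infinity; if it is finite, \<open>sc\<close> makes \<open>E_fun n A \<sigma>\<close> finite
      too and the claim is real arithmetic.\<close>
    proof (cases "E_fun n A \<tau>")
      case PInf
      then show ?thesis using cn assms by auto
    next
      case MInf
      then show ?thesis using E_fun_nonneg[of n A \<tau>] by simp
    next
      case (real e)
      then show ?thesis
        using sc E_fun_nonneg[of n A \<sigma>] unfolding eq
        by (cases "E_fun n A \<sigma>") (auto simp: algebra_simps)
    qed
    also have "\<dots> \<le> young_conj_e (E_fun n A) (c * t)"
      unfolding young_conj_e_def using s by (intro SUP_upper) auto
    finally show ?thesis .
  qed
  moreover have "ereal (c ^ n) * young_conj_e (E_fun n A) t
      = (SUP \<tau>\<in>{0..}. ereal (c ^ n) * (ereal (\<tau> * t) - E_fun n A \<tau>))"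
    unfolding young_conj_e_def using cn by (intro Sup_ereal_mult_left') auto
  ultimately show ?thesis
    using False by (auto simp: B_fun_def intro!: SUP_least)
qed

text \<open>Only arguments with \<open>A \<tau> < s \<tau>\<close> contribute to the supremum, and by convexity they
  form an interval starting at 0.\<close>
lemma young_conj_le_measure:
  assumes "young A" "s > 0" and meas: "{t. 0 < t \<and> A t < s * t} \<in> sets lborel"
  shows "e2ennreal (young_conj A s) \<le> ennreal s * emeasure lborel {t. 0 < t \<and> A t < s * t}"
proof -
  have "young_conj A s \<le> enn2ereal (ennreal s * emeasure lborel {t. 0 < t \<and> A t < s * t})"
    unfolding young_conj_def
  proof (rule SUP_least)
    fix \<tau> :: real assume "\<tau> \<in> {0..}"
    then have "\<tau> \<ge> 0" by simp
    show "ereal (\<tau> * s - A \<tau>) \<le> enn2ereal (ennreal s * emeasure lborel {t. 0 < t \<and> A t < s * t})"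
    proof (cases "A \<tau> < s * \<tau>")
      case False
      then have "ereal (\<tau> * s - A \<tau>) \<le> 0" by (simp add: mult.commute)
      then show ?thesis by (meson enn2ereal_nonneg order_trans)
    next
      case True
      have sub: "{0<..<\<tau>} \<subseteq> {t. 0 < t \<and> A t < s * t}"
      proof
        fix t assume t: "t \<in> {0<..<\<tau>}"
        have "A (\<tau> / (\<tau> / t)) \<le> A \<tau> / (\<tau> / t)"
          using assms t by (intro young_scale_le) (auto simp: field_simps)
        also have "\<dots> < s * t" using True t by (simp add: field_simps)
        finally show "t \<in> {t. 0 < t \<and> A t < s * t}" using t by simp
      qed
      have "ereal (\<tau> * s - A \<tau>) \<le> ereal (s * \<tau>)"
        using assms \<open>\<tau> \<ge> 0\<close> by (auto simp: young_def mult.commute)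
      also have "\<dots> = enn2ereal (ennreal s * emeasure lborel {0<..<\<tau>})"
        using assms \<open>\<tau> \<ge> 0\<close> by (simp flip: ennreal_mult)
      also have "\<dots> \<le> enn2ereal (ennreal s * emeasure lborel {t. 0 < t \<and> A t < s * t})"
        unfolding less_eq_ennreal.rep_eq[symmetric]
        by (intro mult_left_mono emeasure_mono sub meas) auto
      finally show ?thesis .
    qed
  qed
  then have "e2ennreal (young_conj A s) \<le>
      e2ennreal (enn2ereal (ennreal s * emeasure lborel {t. 0 < t \<and> A t < s * t}))"
    by (rule e2ennreal_mono)
  then show ?thesis by simp
qed

lemma nn_integral_powr_tail:
  assumes "p > 0" "a > (0::real)"
  shows "(\<integral>\<^sup>+ s\<in>{a..}. ennreal (s powr (-1 - p)) \<partial>lborel) = ennreal (a powr (- p) / p)"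
proof -
  have "((\<lambda>s. s powr (-1 - p)) has_integral (a powr (- p) / p)) {a..}"
    using has_integral_powr_to_inf[of "-1 - p" a] assms by simp
  then show ?thesis by (intro nn_integral_has_integral_lebesgue') auto
qed

text \<open>Tonelli applied to the region \<open>A t < s t\<close> turns (C1) into integrability of the conjugate.\<close>
lemma E_fun_finite:
  assumes A: "young A" and "n \<ge> 2" and "cond_C1 n A" and "cond_C2 A"
  shows "E_fun n A 1 < \<infinity>"
proof -
  define p where "p = 1 / (real n - 1)"
  have p: "p > 0" "real n / (real n - 1) = 1 + p"
    using assms by (auto simp: p_def field_simps)
  obtain t0 where t0: "t0 > 0"
    and fin: "(\<integral>\<^sup>+ t\<in>{t0..}. ennreal ((t / A t) powr p) \<partial>lborel) < \<infinity>"
    using assms by (auto simp: cond_C1_def p_def)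
  have pos: "A t > 0" if "t > 0" for t
    using assms that by (auto simp: cond_C2_def)
  have cont: "continuous_on {0<..} A"
    using A by (intro convex_on_continuous) (auto simp: young_def intro: convex_on_subset)
  \<comment> \<open>Nothing is known about \<open>A\<close> at negative arguments, and convexity
    gives continuity only on the open half-line; cutting off there yields a Borel function.\<close>
  define A' where "A' = (\<lambda>t. indicator {0<..} t * A t)"
  have A'[measurable]: "A' \<in> borel_measurable borel"
    using borel_measurable_continuous_on_indicator[OF _ cont] by (simp add: A'_def)
  have A'_eq: "A' t = A t" if "t > 0" for t using that by (simp add: A'_def)
  have S_eq: "{t. 0 < t \<and> A t < s * t} = {t\<in>space lborel. 0 < t \<and> A' t < s * t}" for s
    by (auto simp: A'_eq)
  have S_meas: "{t. 0 < t \<and> A t < s * t} \<in> sets lborel" for s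
    unfolding S_eq by measurable
  \<comment> \<open>The kernel s^(-1-n') with n' = 1 + p absorbs the factor \<open>s\<close> of
    \<open>young_conj_le_measure\<close>, leaving the exponent -1-p on the region
    \<open>A t < s * t\<close>.\<close>
  define h where "h = (\<lambda>s t::real. if 1 < s \<and> 0 < t \<and> A' t < s * t then ennreal (s powr (-1 - p)) else 0)"
  have h_meas: "case_prod h \<in> borel_measurable (lborel \<Otimes>\<^sub>M lborel)"
    unfolding h_def by measurable
  have "(\<integral>\<^sup>+ s\<in>{1<..}. e2ennreal (young_conj A s) * ennreal (s powr (-1 - (1 + p))) \<partial>lborel)
      \<le> (\<integral>\<^sup>+ s. (\<integral>\<^sup>+ t. h s t \<partial>lborel) \<partial>lborel)"
  proof (rule nn_integral_mono)
    fix s :: real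
    show "e2ennreal (young_conj A s) * ennreal (s powr (-1 - (1 + p))) * indicator {1<..} s
        \<le> (\<integral>\<^sup>+ t. h s t \<partial>lborel)"
    proof (cases "s > 1")
      case True
      let ?S = "{t. 0 < t \<and> A t < s * t}"
      have "e2ennreal (young_conj A s) * ennreal (s powr (-1 - (1 + p)))
          \<le> ennreal s * emeasure lborel ?S * ennreal (s powr (-1 - (1 + p)))"
        using young_conj_le_measure[OF A _ S_meas, of s] True by (intro mult_right_mono) auto
      also have "\<dots> = ennreal (s * s powr (-1 - (1 + p))) * emeasure lborel ?S"
        using True by (simp add: ennreal_mult mult_ac)
      also have "s * s powr (-1 - (1 + p)) = s powr (-1 - p)"
        using True powr_mult_base[of s "-1 - (1 + p)"] by simp
      also have "ennreal (s powr (-1 - p)) * emeasure lborel ?S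
          = (\<integral>\<^sup>+ t\<in>?S. ennreal (s powr (-1 - p)) \<partial>lborel)"
        using S_meas by (simp add: nn_integral_cmult_indicator)
      also have "\<dots> = (\<integral>\<^sup>+ t. h s t \<partial>lborel)"
        using True by (intro nn_integral_cong) (auto simp: h_def A'_eq split: split_indicator)
      finally show ?thesis using True by simp
    qed simp
  qed
  also have "\<dots> = (\<integral>\<^sup>+ t. (\<integral>\<^sup>+ s. h s t \<partial>lborel) \<partial>lborel)"
    by (rule lborel_pair.Fubini'[OF h_meas, symmetric])
  \<comment> \<open>For \<open>t \<le> t0\<close> only \<open>s > 1\<close> is used, which gives the
    constant 1/p. For \<open>t > t0\<close> the constraint \<open>s > A t / t\<close> gives (1/p) (t
    / A t)^p, a multiple of the integrand in (C1).\<close>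
  also have "\<dots> \<le> (\<integral>\<^sup>+ t. ennreal (1 / p) * indicator {0..t0} t
      + ennreal (1 / p) * (ennreal ((t / A t) powr p) * indicator {t0..} t) \<partial>lborel)"
  proof (rule nn_integral_mono)
    fix t :: real
    have tail: "(\<integral>\<^sup>+ s. h s t \<partial>lborel) \<le> ennreal (a powr (- p) / p)"
      if "a > 0" "\<And>s. 1 < s \<Longrightarrow> 0 < t \<Longrightarrow> A t < s * t \<Longrightarrow> a \<le> s" for a
    proof -
      have "(\<integral>\<^sup>+ s. h s t \<partial>lborel) \<le> (\<integral>\<^sup>+ s\<in>{a..}. ennreal (s powr (-1 - p)) \<partial>lborel)"
        using that(2) by (intro nn_integral_mono) (auto simp: h_def A'_eq split: split_indicator)
      then show ?thesis using nn_integral_powr_tail[OF p(1) that(1)] by simp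
    qed
    consider "t \<le> 0" | "0 < t" "t \<le> t0" | "t > t0" by linarith
    then show "(\<integral>\<^sup>+ s. h s t \<partial>lborel) \<le> ennreal (1 / p) * indicator {0..t0} t
      + ennreal (1 / p) * (ennreal ((t / A t) powr p) * indicator {t0..} t)"
    proof cases
      case 1
      then show ?thesis by (simp add: h_def)
    next
      case 2
      have "(\<integral>\<^sup>+ s. h s t \<partial>lborel) \<le> ennreal (1 powr (- p) / p)"
        by (rule tail) auto
      also have "\<dots> \<le> ennreal (1 / p) * indicator {0..t0} t
          + ennreal (1 / p) * (ennreal ((t / A t) powr p) * indicator {t0..} t)"
        using 2 by simp
      finally show ?thesis .
    next
      case 3
      have "t > 0" using 3 t0 by simp
      have "(\<integral>\<^sup>+ s. h s t \<partial>lborel) \<le> ennreal ((A t / t) powr (- p) / p)"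
        using \<open>t > 0\<close> pos[of t] by (intro tail) (auto simp: field_simps)
      also have "(A t / t) powr (- p) / p = (1 / p) * (t / A t) powr p"
        using \<open>t > 0\<close> pos[of t] by (simp add: powr_minus powr_divide field_simps)
      also have "ennreal \<dots> = ennreal (1 / p) * ennreal ((t / A t) powr p)"
        using p by (subst ennreal_mult) auto
      finally show ?thesis using 3 by simp
    qed
  qed
  also have "\<dots> = ennreal (1 / p) * ennreal t0
      + ennreal (1 / p) * (\<integral>\<^sup>+ t\<in>{t0..}. ennreal ((t / A t) powr p) \<partial>lborel)"
  proof -
    \<comment> \<open>Additivity of the integral requires measurability, which is available for
      \<open>A'\<close>.\<close>
    have eq: "ennreal ((t / A t) powr p) * indicator {t0..} t
        = ennreal ((t / A' t) powr p) * indicator {t0..} t" for t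
      using t0 by (auto simp: A'_eq split: split_indicator)
    show ?thesis
      unfolding eq using t0
      by (subst nn_integral_add) (auto simp: nn_integral_cmult nn_integral_cmult_indicator)
  qed
  also have "\<dots> < \<infinity>"
    using fin by (simp add: ennreal_mult_less_top)
  finally show ?thesis
    unfolding E_fun_def Let_def p(2) by (simp add: top_ennreal.rep_eq less_ennreal.rep_eq)
qed

section \<open>Positivity of B and finiteness of its inverse\<close>

lemma B_fun_pos:
  assumes "young A" "n \<ge> 1" "cond_C1 n A" "cond_C2 A"
  obtains t where "t > 0" "B_fun n A t > 0"
proof (cases "n = 1")
  case True
  show ?thesis
    by (rule that[of 1]) (use assms True in \<open>auto simp: B_fun_def cond_C2_def\<close>)
next
  case False
  then have "E_fun n A 1 < \<infinity>" using assms by (intro E_fun_finite) auto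
  then obtain e where e: "E_fun n A 1 = ereal e"
    using E_fun_nonneg[of n A 1] by (cases "E_fun n A 1") auto
  \<comment> \<open>The argument \<open>e + 1\<close> makes the competitor \<tau> = 1 contribute
    exactly 1 to the supremum.\<close>
  have "ereal 1 = ereal (1 * (e + 1)) - E_fun n A 1" using e by simp
  also have "\<dots> \<le> young_conj_e (E_fun n A) (e + 1)"
    unfolding young_conj_e_def by (rule SUP_upper) auto
  finally have "B_fun n A (e + 1) > 0"
    using False by (auto simp: B_fun_def intro: less_le_trans[of 0 "ereal 1"])
  moreover have "e \<ge> 0" using E_fun_nonneg[of n A 1] e by simp
  ultimately show ?thesis by (intro that[of "e + 1"]) auto
qed

text \<open>Once \<open>B\<close> is positive at one point, \<open>B_fun_scale\<close> drives it
  above every level, so the sublevel sets defining the inverse are bounded.\<close>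

lemma inv_fun_B_finite:
  assumes "young A" "n \<ge> 1" "cond_C1 n A" "cond_C2 A" "s > 0"
  shows "inv_fun (B_fun n A) s < \<infinity>"
proof -
  obtain t0 where t0: "t0 > 0" "B_fun n A t0 > 0"
    using B_fun_pos assms by metis
  \<comment> \<open>\<open>B\<close> may be infinite at \<open>t0\<close>, so a positive real lower
    bound is used instead of its value.\<close>
  obtain b where b: "b > 0" "ereal b \<le> B_fun n A t0"
    using t0(2) ereal_dense2[of 0 "B_fun n A t0"] by (auto simp: less_imp_le)
  define c where "c = max 1 ((s + 1) / b)"
  have "t \<le> c * t0" if "t \<ge> 0" "B_fun n A t \<le> ereal s" for t
  proof (rule ccontr)
    assume "\<not> t \<le> c * t0"
    define k where "k = t / t0"
    have k: "k \<ge> c" "k \<ge> 1" "t = k * t0"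
      
    proof -
      show "t = k * t0" "k \<ge> c" using \<open>\<not> _\<close> t0 by (auto simp: k_def field_simps)
      then show "k \<ge> 1" by (simp add: c_def)
    qed
    have "s + 1 \<le> k * b" using k(1) b by (auto simp: c_def field_simps)
    also have "\<dots> \<le> k ^ n * b"
      using self_le_power[of k n] k assms b by (intro mult_right_mono) auto
    finally have "ereal (s + 1) \<le> ereal (k ^ n) * ereal b" by simp
    also have "\<dots> \<le> ereal (k ^ n) * B_fun n A t0"
      using b k by (intro ereal_mult_left_mono) auto
    also have "\<dots> \<le> B_fun n A t"
      using B_fun_scale[of A n k t0] k assms t0 by simp
    also have "\<dots> \<le> ereal s" by fact
    finally show False by simp
  qed
  then have "inv_fun (B_fun n A) s \<le> ereal (c * t0)"
    unfolding inv_fun_def by (intro SUP_least) auto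
  then show ?thesis by (auto simp: less_top[symmetric])
qed

text \<open>Since \<open>B (c t) \<ge> c ^ n * B t\<close>, the function \<open>s \<mapsto> (B\<^sup>-\<^sup>1 s) ^ n\<close> grows at most linearly beyond
  \<open>1 / \<rho>\<close>; this replaces Jensen's inequality and is the source of the
  factor 2 in the theorem.\<close>
lemma power_le_inv_fun_B:
  assumes A: "young A" and n: "n \<ge> 1" and "\<rho> > 0" "r > 0" "\<alpha> \<ge> 0" "t \<ge> 0"
    and le: "ereal r * B_fun n A t \<le> ereal \<alpha>"
  shows "ennreal (r * t ^ n) \<le> e2ennreal (inv_fun (B_fun n A) (1 / \<rho>)) ^ n * ennreal (r + \<alpha> * \<rho>)"
proof -
  \<comment> \<open>This is the least factor at least 1 for which
    \<open>\<alpha> / (r * c) \<le> 1 / \<rho>\<close>. Its \<open>n\<close>-th root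
    \<open>k\<close> is the factor by which \<open>t\<close> must be reduced to enter the sublevel
    set at 1/\<rho>.\<close>
  define c where "c = max 1 (\<rho> * \<alpha> / r)"
  define k where "k = root n c"
  have c: "c \<ge> 1" by (simp add: c_def)
  have k: "k \<ge> 1" "k ^ n = c"
    using c n by (simp_all add: k_def)
  define s where "s = t / k"
  have s: "s \<ge> 0" "t = k * s" using k assms by (simp_all add: s_def)
  have "ereal (r * c) * B_fun n A s = ereal r * (ereal (k ^ n) * B_fun n A s)"
    using k by (simp add: mult.assoc flip: times_ereal.simps)
  also have "\<dots> \<le> ereal r * B_fun n A t"
    using B_fun_scale[OF A n k(1) s(1)] s(2) \<open>r > 0\<close> by (intro ereal_mult_left_mono) auto
  also have "\<dots> \<le> ereal \<alpha>" by (rule le)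
  finally have "B_fun n A s \<le> ereal (\<alpha> / (r * c))"
    using \<open>r > 0\<close> c by (cases "B_fun n A s") (auto simp: field_simps)
  also have "\<alpha> / (r * c) \<le> 1 / \<rho>"
  proof -
    have "\<rho> * \<alpha> / r \<le> c" by (simp add: c_def)
    then show ?thesis using \<open>r > 0\<close> c \<open>\<rho> > 0\<close> by (simp add: field_simps)
  qed
  finally have "ereal s \<le> inv_fun (B_fun n A) (1 / \<rho>)"
    unfolding inv_fun_def using s by (intro SUP_upper) auto
  then have "ennreal s \<le> e2ennreal (inv_fun (B_fun n A) (1 / \<rho>))"
    using e2ennreal_mono by fastforce
  then have "ennreal s ^ n \<le> e2ennreal (inv_fun (B_fun n A) (1 / \<rho>)) ^ n"
    by (intro power_mono) auto
  \<comment> \<open>The left side is the maximum of \<open>r\<close> and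
    \<open>\<alpha> * \<rho>\<close>; the sum is preferred because it is additive over
    cubes.\<close>
  moreover have "r * c \<le> r + \<alpha> * \<rho>"
    using \<open>r > 0\<close> \<open>\<rho> > 0\<close> \<open>\<alpha> \<ge> 0\<close> by (auto simp: c_def max_def field_simps)
  moreover have "ennreal (r * t ^ n) = ennreal s ^ n * ennreal (r * c)"
    using s k \<open>r > 0\<close> c
    by (simp add: power_mult_distrib ennreal_power mult_ac flip: ennreal_mult)
  ultimately show ?thesis by (simp add: mult_mono ennreal_leI)
qed

subsection \<open>Images of cubes\<close>

lemma cube_eq_box:
  fixes a b :: "'a::euclidean_space"
  assumes "\<forall>i\<in>Basis. b \<bullet> i - a \<bullet> i = r"
  shows "b = a + r *\<^sub>R One"
proof (rule euclidean_eqI)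
  fix i :: 'a assume "i \<in> Basis"
  moreover from this assms have "b \<bullet> i = a \<bullet> i + r" by fastforce
  ultimately show "b \<bullet> i = (a + r *\<^sub>R One) \<bullet> i" by (simp add: inner_add_left)
qed

lemma diameter_cube:
  fixes a :: "real^'n"
  assumes "r > 0"
  shows "diameter (box a (a + r *\<^sub>R One)) = r * sqrt (real CARD('n))"
proof -
  have ne: "box a (a + r *\<^sub>R One) \<noteq> {}"
    using assms by (simp add: box_ne_empty inner_add_left)
  have "diameter (box a (a + r *\<^sub>R One)) = diameter (cbox a (a + r *\<^sub>R One))"
    using diameter_closure[OF bounded_box, of a "a + r *\<^sub>R One"] ne by simp
  also have "\<dots> = dist a (a + r *\<^sub>R One)"
    using assms by (intro diameter_cbox) (auto simp: inner_add_left)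
  also have "\<dots> = r * norm (One :: real^'n)"
    using assms by (simp add: dist_norm)
  also have "norm (One :: real^'n) = sqrt (real CARD('n))"
    unfolding norm_eq_sqrt_inner by (subst euclidean_inner) simp
  finally show ?thesis .
qed

lemma emeasure_cube:
  fixes a :: "'a::euclidean_space"
  assumes "r > 0"
  shows "emeasure lebesgue (box a (a + r *\<^sub>R One)) = ennreal (r ^ DIM('a))"
  using assms by (simp add: inner_add_left)

text \<open>The oscillation estimate concerns open cubes, whereas a covering uses closed ones; by
  continuity the image of the closed box lies in the closure of the image of the open one.
  Boundedness makes the real-valued \<open>diameter\<close> meaningful.\<close>

lemma ediam_image_cbox_le:
  fixes u :: "'a::euclidean_space \<Rightarrow> 'b::euclidean_space"
  assumes "continuous_on (cbox a b) u" "box a b \<noteq> {}" "bounded (u ` box a b)"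
  shows "ediam (u ` cbox a b) \<le> ennreal (diameter (u ` box a b))"
proof -
  have sub: "u ` cbox a b \<subseteq> closure (u ` box a b)"
    using continuous_image_closure_subset[OF assms(1), of "box a b"] assms(2) by simp
  have "dist x y \<le> diameter (u ` box a b)" if "x \<in> u ` cbox a b" "y \<in> u ` cbox a b" for x y
    using diameter_bounded_bound[of "closure (u ` box a b)" x y] that sub assms(3)
    by (auto simp: diameter_closure)
  then show ?thesis
    unfolding ediam_def by (intro SUP_least ennreal_leI) auto
qed

lemma orlicz_int_mono: "S \<subseteq> T \<Longrightarrow> orlicz_int A S f l \<le> orlicz_int A T f l"
  unfolding orlicz_int_def by (intro nn_integral_mono) (auto split: split_indicator)

text \<open>Apply \<open>power_le_inv_fun_B\<close> with \<open>r\<close> = d(Q)^n / \<kappa>, which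
  is a fixed multiple of the volume of Q. The last factor is then additive in Q, and the factors
  before it do not depend on Q.\<close>

lemma ediam_image_cube_power_le:
  fixes u :: "real^'n \<Rightarrow> real^'m"
  assumes A: "young A" and \<kappa>: "\<kappa> > 0" "kappa_prop \<kappa> A \<Omega> TYPE(real^'n \<Rightarrow> real^'m)"
    and V: "V1A A \<Omega> u G" and cont: "continuous_on \<Omega> u"
    and l: "l > 0" "orlicz_int A \<Omega> (\<lambda>x. norm (G x)) l < \<infinity>"
    and r: "r > 0" and sub: "cbox a (a + r *\<^sub>R One) \<subseteq> \<Omega>" and \<rho>: "\<rho> > 0"
  shows "ediam (u ` cbox a (a + r *\<^sub>R One)) ^ CARD('n)
    \<le> ennreal (\<kappa> ^ (CARD('n) + 1) * l ^ CARD('n))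
        * e2ennreal (inv_fun (B_fun CARD('n) A) (1 / \<rho>)) ^ CARD('n)
        * (emeasure lebesgue (box a (a + r *\<^sub>R One))
             * ennreal (real CARD('n) powr (real CARD('n) / 2) / \<kappa>)
           + orlicz_int A (box a (a + r *\<^sub>R One)) (\<lambda>x. norm (G x)) l * ennreal \<rho>)"
proof -
  let ?n = "CARD('n)" and ?Q = "box a (a + r *\<^sub>R One)"
  define d where "d = diameter (u ` ?Q)"
  define q where "q = diameter ?Q"
  define t where "t = d / (\<kappa> * l * q)"
  have ne: "?Q \<noteq> {}" using r by (simp add: box_ne_empty inner_add_left)
  have subQ: "?Q \<subseteq> \<Omega>" using sub box_subset_cbox by blast
  have q: "q = r * sqrt (real ?n)" unfolding q_def by (rule diameter_cube[OF r])
  have qpos: "q > 0" using r by (simp add: q)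
  have fin: "orlicz_int A ?Q (\<lambda>x. norm (G x)) l < \<infinity>"
    using orlicz_int_mono[OF subQ] l(2) by (rule le_less_trans)
  then obtain \<alpha> where \<alpha>: "\<alpha> \<ge> 0" "orlicz_int A ?Q (\<lambda>x. norm (G x)) l = ennreal \<alpha>"
    by (metis enn2real_nonneg ennreal_enn2real infinity_ennreal_def)
  have "open_cube ?Q" using r unfolding open_cube_def by blast
  then have bd: "bounded (u ` ?Q)"
    and kap: "ereal (q ^ ?n / \<kappa>) * B_fun ?n A t \<le> ereal \<alpha>"
    using \<kappa>(2) V cont subQ l(1) fin \<alpha> unfolding kappa_prop_def t_def d_def q_def
    by (metis enn2ereal_ennreal)+
  have d: "d \<ge> 0" unfolding d_def using bd by (rule diameter_ge_0)
  then have t: "t \<ge> 0" using \<kappa> l qpos by (simp add: t_def)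
  have qn: "q ^ ?n / \<kappa> = r ^ ?n * (real ?n powr (real ?n / 2) / \<kappa>)"
  proof -
    have "sqrt (real ?n) ^ ?n = (real ?n powr (1 / 2)) powr real ?n"
      by (simp add: powr_half_sqrt powr_realpow)
    also have "\<dots> = real ?n powr (real ?n / 2)" by (simp add: powr_powr)
    finally show ?thesis by (simp add: q power_mult_distrib)
  qed
  \<comment> \<open>By definition \<open>d = \<kappa> * l * q * t\<close>; the extra power of
    \<kappa> compensates the weight \<open>q ^ ?n / \<kappa>\<close> in front of
    \<open>B\<close>.\<close>
  have dn: "d ^ ?n = \<kappa> ^ (?n + 1) * l ^ ?n * (q ^ ?n / \<kappa> * t ^ ?n)"
    using \<kappa>(1) l(1) qpos by (simp add: t_def power_divide power_mult_distrib field_simps)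
  have "ediam (u ` cbox a (a + r *\<^sub>R One)) ^ ?n \<le> ennreal d ^ ?n"
    unfolding d_def using cont sub ne bd
    by (intro power_mono ediam_image_cbox_le) (auto intro: continuous_on_subset)
  also have "\<dots> = ennreal (\<kappa> ^ (?n + 1) * l ^ ?n) * ennreal (q ^ ?n / \<kappa> * t ^ ?n)"
    unfolding ennreal_power[OF d] dn using \<kappa>(1) l(1) qpos t by (intro ennreal_mult) auto
  also have "\<dots> \<le> ennreal (\<kappa> ^ (?n + 1) * l ^ ?n)
      * (e2ennreal (inv_fun (B_fun ?n A) (1 / \<rho>)) ^ ?n * ennreal (q ^ ?n / \<kappa> + \<alpha> * \<rho>))"
    using qpos \<kappa>(1) \<alpha> t kap by (intro mult_left_mono power_le_inv_fun_B[OF A _ \<rho>]) auto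
  also have "ennreal (q ^ ?n / \<kappa> + \<alpha> * \<rho>)
      = emeasure lebesgue ?Q * ennreal (real ?n powr (real ?n / 2) / \<kappa>)
        + orlicz_int A ?Q (\<lambda>x. norm (G x)) l * ennreal \<rho>"
    unfolding qn emeasure_cube[OF r] \<alpha>(2)
    using r \<kappa>(1) \<alpha>(1) \<rho> by (simp flip: ennreal_mult ennreal_plus)
  finally show ?thesis by (simp only: mult.assoc)
qed

subsection \<open>Decomposition of open sets into cubes\<close>

text \<open>\<open>covering_lemma\<close> decomposes sets inside one bounded box, so it is applied
  in each unit cube of the integer lattice and the resulting dyadic cubes are collected.\<close>

lemma open_nonoverlapping_cubes:
  fixes U :: "(real^'n) set"
  assumes "open U"
  obtains Q :: "nat \<Rightarrow> (real^'n) set" where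
    "\<And>i. Q i = {} \<or> (\<exists>a r. r > 0 \<and> Q i = cbox a (a + r *\<^sub>R One))"
    "disjoint_family (\<lambda>i. interior (Q i))" "(\<Union>i. Q i) = U"
proof -
  define k where "k = (\<lambda>f::'n \<Rightarrow> int. (\<chi> i. of_int (f i)) :: real^'n)"
  define C where "C = (\<lambda>f. cbox (k f) (k f + One))"
  have nth_One: "(One :: real^'n) $ i = 1" for i
    by (simp add: cart_eq_inner_axis)
  then have sum_Basis_nth: "(\<Sum>b\<in>(Basis :: (real^'n) set). b $ i) = 1" for i
    by simp
  have ne: "box (k f) (k f + One) \<noteq> {}" for f
    by (simp add: box_ne_empty inner_add_left)
  \<comment> \<open>Each cube of the covering lies in the gauge set of one of its points in
    \<open>U\<close>; taking \<open>U\<close> itself there keeps every cube inside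
    \<open>U\<close>.\<close>
  have "gauge (\<lambda>x. if x \<in> U then U else UNIV)"
    using assms by (auto simp: gauge_def)
  note cov = covering_lemma[OF _ ne this, of "U \<inter> C f" f for f]
  have "\<exists>D. countable D \<and> \<Union>D \<subseteq> C f
      \<and> (\<forall>K\<in>D. \<exists>a r. r > 0 \<and> K = cbox a (a + r *\<^sub>R One))
      \<and> pairwise (\<lambda>A B. interior A \<inter> interior B = {}) D
      \<and> (\<forall>K\<in>D. K \<subseteq> U) \<and> U \<inter> C f \<subseteq> \<Union>D" for f
  proof (rule cov[of f])
    fix D assume D: "countable D" "\<Union>D \<subseteq> cbox (k f) (k f + One)"
      "\<And>K. K \<in> D \<Longrightarrow> interior K \<noteq> {} \<and> (\<exists>c d. K = cbox c d)"
      "pairwise (\<lambda>A B. interior A \<inter> interior B = {}) D"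
      "\<And>K. K \<in> D \<Longrightarrow> \<exists>x\<in>U \<inter> C f \<inter> K. K \<subseteq> (if x \<in> U then U else UNIV)"
      "\<And>u v. cbox u v \<in> D \<Longrightarrow> \<exists>n. \<forall>i\<in>Basis. v \<bullet> i - u \<bullet> i = ((k f + One) \<bullet> i - k f \<bullet> i) / 2 ^ n"
      "U \<inter> C f \<subseteq> \<Union>D"
    have "\<exists>a r. r > 0 \<and> K = cbox a (a + r *\<^sub>R One)" if K: "K \<in> D" for K
    proof -
      obtain a b where ab: "K = cbox a b" using D(3) K by blast
      then obtain n where "\<forall>i\<in>Basis. b \<bullet> i - a \<bullet> i = ((k f + One) \<bullet> i - k f \<bullet> i) / 2 ^ n"
        using D(6) K by blast
      then have "\<forall>i\<in>Basis. b \<bullet> i - a \<bullet> i = 1 / 2 ^ n" by (simp add: inner_add_left)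
      from cube_eq_box[OF this] ab show ?thesis
        by (intro exI[of _ a] exI[of _ "1 / 2 ^ n"]) auto
    qed
    moreover have "K \<subseteq> U" if "K \<in> D" for K
      using D(5)[OF that] by auto
    ultimately show ?thesis using D(1,2,4,7) unfolding C_def by (intro exI[of _ D]) auto
  qed (auto simp: C_def)
  then obtain D where D: "\<And>f. countable (D f)" "\<And>f. \<Union>(D f) \<subseteq> C f"
      "\<And>f K. K \<in> D f \<Longrightarrow> \<exists>a r. r > 0 \<and> K = cbox a (a + r *\<^sub>R One)"
      "\<And>f. pairwise (\<lambda>A B. interior A \<inter> interior B = {}) (D f)"
      "\<And>f K. K \<in> D f \<Longrightarrow> K \<subseteq> U" "\<And>f. U \<inter> C f \<subseteq> \<Union>(D f)"
    by metis
  define T where "T = (\<Union>f. D f)"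
  have T: "countable T" unfolding T_def using D(1) by auto
  have disjC: "interior (C f) \<inter> interior (C g) = {}" if "f \<noteq> g" for f g
  proof -
    obtain i where i: "f i \<noteq> g i" using \<open>f \<noteq> g\<close> by blast
    have "x \<notin> box (k g) (k g + One)" if "x \<in> box (k f) (k f + One)" for x
    proof
      assume "x \<in> box (k g) (k g + One)"
      with that have "of_int (f i) < x $ i" "x $ i < of_int (f i) + 1"
        "of_int (g i) < x $ i" "x $ i < of_int (g i) + 1"
        by (auto simp: mem_box_cart k_def sum_Basis_nth)
      then show False using i by linarith
    qed
    then show ?thesis by (auto simp: C_def)
  qed
  have disjT: "interior K \<inter> interior L = {}" if KL: "K \<in> T" "L \<in> T" "K \<noteq> L" for K L
  proof -
    obtain f g where fg: "K \<in> D f" "L \<in> D g" using KL by (auto simp: T_def)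
    show ?thesis
    proof (cases "f = g")
      case True
      then show ?thesis using D(4)[of f] fg KL(3) by (auto simp: pairwise_def)
    next
      case False
      have "interior K \<subseteq> interior (C f)" "interior L \<subseteq> interior (C g)"
        using D(2) fg by (auto intro!: interior_mono)
      then show ?thesis using disjC[OF False] by blast
    qed
  qed
  have UT: "\<Union>T = U"
  proof
    show "\<Union>T \<subseteq> U" using D(5) by (auto simp: T_def)
    show "U \<subseteq> \<Union>T"
    proof
      fix x assume "x \<in> U"
      define f where "f = (\<lambda>i. \<lfloor>x $ i\<rfloor>)"
      have "x \<in> C f"
        by (auto simp: C_def f_def k_def mem_box_cart sum_Basis_nth)
      then show "x \<in> \<Union>T" using D(6)[of f] \<open>x \<in> U\<close> unfolding T_def by blast
    qed
  qed
  \<comment> \<open>Indices outside the enumeration get the empty set: for finite \<open>T\<close>,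
    \<open>from_nat_into\<close> would repeat a cube there and destroy disjointness.\<close>
  define Q where "Q = (\<lambda>i. if i \<in> to_nat_on T ` T then from_nat_into T i else {})"
  have Q_to_nat: "Q (to_nat_on T K) = K" if "K \<in> T" for K
    using from_nat_into_to_nat_on[OF T that] that by (simp add: Q_def)
  have QT: "\<exists>K\<in>T. i = to_nat_on T K \<and> Q i = K" if "Q i \<noteq> {}" for i
  proof -
    have "i \<in> to_nat_on T ` T" using that unfolding Q_def by presburger
    then show ?thesis using Q_to_nat by blast
  qed
  show ?thesis
  proof (rule that[of Q])
    show "Q i = {} \<or> (\<exists>a r. r > 0 \<and> Q i = cbox a (a + r *\<^sub>R One))" for i
    proof (cases "Q i = {}")
      case False
      then have "Q i \<in> T" using QT by blast
      then show ?thesis using D(3) unfolding T_def by blast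
    qed simp
    show "disjoint_family (\<lambda>i. interior (Q i))"
      unfolding disjoint_family_on_def
    proof (intro ballI impI)
      fix i j :: nat assume "i \<noteq> j"
      show "interior (Q i) \<inter> interior (Q j) = {}"
      proof (cases "Q i = {} \<or> Q j = {}")
        case False
        then obtain K L where "K \<in> T" "L \<in> T" "i = to_nat_on T K" "j = to_nat_on T L"
            "Q i = K" "Q j = L"
          using QT[of i] QT[of j] by blast
        then show ?thesis using disjT[of K L] \<open>i \<noteq> j\<close> by metis
      qed auto
    qed
    show "(\<Union>i. Q i) = U"
    proof
      show "(\<Union>i. Q i) \<subseteq> U" unfolding UT[symmetric] using QT by blast
      show "U \<subseteq> (\<Union>i. Q i)"
      proof
        fix x assume "x \<in> U"
        then obtain K where "K \<in> T" "x \<in> K" using UT by blast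
        then have "x \<in> Q (to_nat_on T K)" using Q_to_nat by simp
        then show "x \<in> (\<Union>i. Q i)" by blast
      qed
    qed
  qed
qed

subsection \<open>Summation over the cubes\<close>

lemma borel_measurable_orlicz_integrand:
  fixes \<Omega> :: "'a::euclidean_space set"
  assumes A: "young A" and "\<Omega> \<in> sets lebesgue" and f: "f \<in> borel_measurable (lebesgue_on \<Omega>)" and "l > 0"
  shows "(\<lambda>x. ennreal (A (\<bar>f x\<bar> / l)) * indicator \<Omega> x) \<in> borel_measurable lebesgue"
proof -
  \<comment> \<open>Extending \<open>A\<close> by \<open>A 0\<close> to the left gives a function
    monotone on the whole line, hence Borel.\<close>
  define A' where "A' = (\<lambda>t. A (max 0 t))"
  have "mono A'"
    unfolding A'_def by (intro monoI young_mono[OF A]) auto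
  then have A'_meas: "A' \<in> borel_measurable borel"
    by (rule borel_measurable_mono)
  have "(\<lambda>x. \<bar>f x\<bar> / l) \<in> borel_measurable (lebesgue_on \<Omega>)"
    using f by measurable
  then have "(\<lambda>x. ennreal (A' (\<bar>f x\<bar> / l))) \<in> borel_measurable (lebesgue_on \<Omega>)"
    using A'_meas by measurable
  moreover have "A' (\<bar>f x\<bar> / l) = A (\<bar>f x\<bar> / l)" for x
    using \<open>l > 0\<close> by (simp add: A'_def max_def)
  ultimately show ?thesis
    using assms(2) by (simp add: borel_measurable_restrict_space_iff_ennreal)
qed

text \<open>Viewed as a measure, the energy is countably additive, as needed for summing over cubes,
  and absolutely continuous, as needed for null sets.\<close>

lemma orlicz_int_as_measure:
  fixes \<Omega> :: "'a::euclidean_space set"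
  assumes "young A" "\<Omega> \<in> sets lebesgue" "f \<in> borel_measurable (lebesgue_on \<Omega>)" "l > 0"
  obtains \<mu> where "sets \<mu> = sets lebesgue" "absolutely_continuous lebesgue \<mu>"
    "\<And>S. S \<in> sets lebesgue \<Longrightarrow> S \<subseteq> \<Omega> \<Longrightarrow> emeasure \<mu> S = orlicz_int A S f l"
proof -
  define h where "h = (\<lambda>x. ennreal (A (\<bar>f x\<bar> / l)) * indicator \<Omega> x)"
  have h: "h \<in> borel_measurable lebesgue"
    unfolding h_def using assms by (rule borel_measurable_orlicz_integrand)
  show ?thesis
  proof (rule that[of "density lebesgue h"])
    fix S assume S: "S \<in> sets lebesgue" "S \<subseteq> \<Omega>"
    have "emeasure (density lebesgue h) S = (\<integral>\<^sup>+ x. h x * indicator S x \<partial>lebesgue)"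
      using h S(1) by (rule emeasure_density)
    also have "\<dots> = orlicz_int A S f l"
      unfolding orlicz_int_def h_def using S(2)
      by (intro nn_integral_cong) (auto split: split_indicator)
    finally show "emeasure (density lebesgue h) S = orlicz_int A S f l" .
  qed (use h in \<open>auto intro: absolutely_continuousI_density\<close>)
qed

lemma hcontent_le:
  assumes "F \<subseteq> (\<Union>i. C i)"
  shows "hcontent n F \<le> (\<Sum>i. ediam (C i) ^ n)"
  unfolding hcontent_def using assms by (intro INF_lower2[of C]) simp_all

lemma ediam_empty [simp]: "ediam {} = 0"
  by (simp add: ediam_def bot_ennreal)

lemma hcontent_image_le:
  fixes u :: "real^'n \<Rightarrow> real^'m"
  assumes "open \<Omega>" and A: "young A" and \<kappa>: "\<kappa> > 0" "kappa_prop \<kappa> A \<Omega> TYPE(real^'n \<Rightarrow> real^'m)"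
    and V: "V1A A \<Omega> u G" and cont: "continuous_on \<Omega> u"
    and l: "l > 0" "orlicz_int A \<Omega> (\<lambda>x. norm (G x)) l < \<infinity>"
    and U: "open U" "U \<subseteq> \<Omega>" "E \<subseteq> U" and \<rho>: "\<rho> > 0"
  shows "hcontent CARD('n) (u ` E)
    \<le> ennreal (\<kappa> ^ (CARD('n) + 1) * l ^ CARD('n))
        * e2ennreal (inv_fun (B_fun CARD('n) A) (1 / \<rho>)) ^ CARD('n)
        * (emeasure lebesgue U * ennreal (real CARD('n) powr (real CARD('n) / 2) / \<kappa>)
           + orlicz_int A U (\<lambda>x. norm (G x)) l * ennreal \<rho>)"
proof -
  let ?n = "CARD('n)" and ?f = "\<lambda>x. norm (G x)"
  let ?c = "ennreal (real ?n powr (real ?n / 2) / \<kappa>)"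
  let ?K = "ennreal (\<kappa> ^ (?n + 1) * l ^ ?n) * e2ennreal (inv_fun (B_fun ?n A) (1 / \<rho>)) ^ ?n"
  obtain Q :: "nat \<Rightarrow> _" where Q: "\<And>i. Q i = {} \<or> (\<exists>a r. r > 0 \<and> Q i = cbox a (a + r *\<^sub>R One))"
    "disjoint_family (\<lambda>i. interior (Q i))" "(\<Union>i. Q i) = U"
    by (rule open_nonoverlapping_cubes[OF U(1)]) (rule that)
  have \<Omega>_leb: "\<Omega> \<in> sets lebesgue" using \<open>open \<Omega>\<close> by auto
  have f_meas: "?f \<in> borel_measurable (lebesgue_on \<Omega>)"
    using V by (simp add: V1A_def in_orlicz_def)
  obtain \<mu> where \<mu>: "sets \<mu> = sets lebesgue" "absolutely_continuous lebesgue \<mu>"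
    "\<And>S. S \<in> sets lebesgue \<Longrightarrow> S \<subseteq> \<Omega> \<Longrightarrow> emeasure \<mu> S = orlicz_int A S ?f l"
    by (rule orlicz_int_as_measure[OF A \<Omega>_leb f_meas l(1)]) (rule that)
  have open_leb: "S \<in> sets lebesgue" if "open S" for S :: "(real^'n) set"
    using that by auto
  have intU: "(\<Union>i. interior (Q i)) \<subseteq> U"
    using Q(3) interior_subset by blast
  have each: "ediam (u ` Q i) ^ ?n
      \<le> ?K * (emeasure lebesgue (interior (Q i)) * ?c + emeasure \<mu> (interior (Q i)) * ennreal \<rho>)" for i
  proof (cases "Q i = {}")
    case True
    then show ?thesis by (simp add: power_0_left)
  next
    case False
    then obtain a r where ar: "r > 0" "Q i = cbox a (a + r *\<^sub>R One)" using Q(1) by blast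
    have sub: "cbox a (a + r *\<^sub>R One) \<subseteq> \<Omega>" using ar(2) Q(3) U(2) by blast
    then have "emeasure \<mu> (box a (a + r *\<^sub>R One)) = orlicz_int A (box a (a + r *\<^sub>R One)) ?f l"
      using box_subset_cbox by (intro \<mu>(3)) (blast intro: open_leb)+
    then show ?thesis
      using ediam_image_cube_power_le[OF A \<kappa> V cont l ar(1) sub \<rho>] ar(2) by simp
  qed
  have sum_le: "(\<Sum>i. emeasure M (interior (Q i))) \<le> emeasure M U" if "sets M = sets lebesgue" for M
  proof -
    have "(\<Sum>i. emeasure M (interior (Q i))) = emeasure M (\<Union>i. interior (Q i))"
      using Q(2) by (intro suminf_emeasure) (auto simp: that)
    also have "\<dots> \<le> emeasure M U"
      using U(1) by (intro emeasure_mono intU) (auto simp: that)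
    finally show ?thesis .
  qed
  have "u ` E \<subseteq> (\<Union>i. u ` Q i)" using U(3) Q(3) by blast
  then have "hcontent ?n (u ` E) \<le> (\<Sum>i. ediam (u ` Q i) ^ ?n)" by (rule hcontent_le)
  also have "\<dots> \<le> (\<Sum>i. ?K * (emeasure lebesgue (interior (Q i)) * ?c + emeasure \<mu> (interior (Q i)) * ennreal \<rho>))"
    by (intro suminf_le each) auto
  also have "\<dots> = ?K * ((\<Sum>i. emeasure lebesgue (interior (Q i))) * ?c + (\<Sum>i. emeasure \<mu> (interior (Q i))) * ennreal \<rho>)"
    by (simp add: suminf_add[symmetric] ennreal_suminf_multc)
  also have "\<dots> \<le> ?K * (emeasure lebesgue U * ?c + emeasure \<mu> U * ennreal \<rho>)"
    by (intro mult_left_mono add_mono mult_right_mono sum_le \<mu>(1)) auto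
  also have "emeasure \<mu> U = orlicz_int A U ?f l"
    using U by (intro \<mu>(3)) auto
  finally show ?thesis .
qed

subsection \<open>Outer measure and Luxemburg norm\<close>

text \<open>Half of \<open>e\<close> pays for a measurable superset of \<open>E\<close>, the other
  half for an open set around that superset.\<close>

lemma louter_open_cover:
  fixes E :: "'a::euclidean_space set"
  assumes "louter E < \<infinity>" "e > 0"
  obtains T where "open T" "E \<subseteq> T" "emeasure lebesgue T < louter E + ennreal e"
proof -
  have "louter E < louter E + ennreal (e / 2)"
    using assms by (cases "louter E") (auto simp: ennreal_less_iff simp flip: ennreal_plus)
  then obtain M where M: "M \<in> sets lebesgue" "E \<subseteq> M" "emeasure lebesgue M < louter E + ennreal (e / 2)"
    unfolding louter_def by (subst (asm) INF_less_iff) (auto simp: louter_def)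
  obtain T where T: "open T" "M \<subseteq> T" "T - M \<in> lmeasurable" "emeasure lebesgue (T - M) < ennreal (e / 2)"
    using sets_lebesgue_outer_open[OF M(1), of "e / 2"] assms by auto
  have "emeasure lebesgue T = emeasure lebesgue M + emeasure lebesgue (T - M)"
    using M T by (subst plus_emeasure) (auto simp: Un_absorb1)
  also have "\<dots> < louter E + ennreal (e / 2) + ennreal (e / 2)"
    using M(3) T(4) by (rule add_strict_mono)
  also have "\<dots> = louter E + ennreal e"
    using assms by (simp add: add.assoc flip: ennreal_plus)
  finally show ?thesis using that[of T] T M by blast
qed

text \<open>A minimizing sequence stands in for the norm itself, which may be 0 and then is not an
  admissible scale.\<close>

lemma lux_norm_approx:
  assumes A: "young A" and "\<Omega> \<in> sets lebesgue" and f: "in_orlicz A \<Omega> f"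
  obtains N L where "N \<ge> 0" "lux_norm A \<Omega> f = ennreal N" "\<And>k. L k > 0"
    "\<And>k::nat. orlicz_int A \<Omega> f (L k) \<le> 1" "L \<longlonglongrightarrow> N"
proof -
  obtain l where l: "l > 0" "orlicz_int A \<Omega> f l < \<infinity>"
    using f by (auto simp: in_orlicz_def)
  then obtain b where b: "b \<ge> 0" "orlicz_int A \<Omega> f l = ennreal b"
    by (metis enn2real_nonneg ennreal_enn2real infinity_ennreal_def)
  \<comment> \<open>\<open>c \<ge> 1\<close> allows \<open>young_scale_le\<close>;
    \<open>c \<ge> b\<close> brings the integral at scale \<open>l * c\<close> down to at most
    1.\<close>
  define c where "c = max 1 b"
  have c: "c \<ge> 1" "c \<ge> b" by (auto simp: c_def)
  have "orlicz_int A \<Omega> f (l * c)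
      \<le> (\<integral>\<^sup>+ x. ennreal (1 / c) * (ennreal (A (\<bar>f x\<bar> / l)) * indicator \<Omega> x) \<partial>lebesgue)"
    unfolding orlicz_int_def
  proof (intro nn_integral_mono)
    fix x
    have "A (\<bar>f x\<bar> / l / c) \<le> A (\<bar>f x\<bar> / l) / c"
      using l c by (intro young_scale_le[OF A]) auto
    moreover have "0 \<le> A (\<bar>f x\<bar> / l)" using A l by (simp add: young_def)
    ultimately show "ennreal (A (\<bar>f x\<bar> / (l * c))) * indicator \<Omega> x
        \<le> ennreal (1 / c) * (ennreal (A (\<bar>f x\<bar> / l)) * indicator \<Omega> x)"
      using c by (auto split: split_indicator simp flip: ennreal_mult intro!: ennreal_leI)
  qed
  also have "\<dots> = ennreal (1 / c) * ennreal b"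
    using borel_measurable_orlicz_integrand[OF A assms(2) _ l(1)] f b(2)
    by (subst nn_integral_cmult) (auto simp: in_orlicz_def orlicz_int_def)
  also have "\<dots> = ennreal (b / c)"
    using c b by (simp flip: ennreal_mult)
  also have "\<dots> \<le> 1"
    using c b by (simp add: ennreal_le_1)
  finally have lc: "orlicz_int A \<Omega> f (l * c) \<le> 1" .
  let ?S = "{l. l > 0 \<and> orlicz_int A \<Omega> f l \<le> 1}"
  have "lux_norm A \<Omega> f \<le> ennreal (l * c)"
    unfolding lux_norm_def using lc l c by (intro INF_lower2[of "l * c"]) auto
  then have "lux_norm A \<Omega> f < \<infinity>"
    by (rule le_less_trans) simp
  then obtain N where N: "N \<ge> 0" "lux_norm A \<Omega> f = ennreal N"
    by (metis enn2real_nonneg ennreal_enn2real infinity_ennreal_def)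
  have "\<exists>m\<in>?S. m < N + inverse (real (Suc k))" for k :: nat
  proof -
    have less: "lux_norm A \<Omega> f < ennreal (N + inverse (real (Suc k)))"
      using N by (simp add: ennreal_less_iff)
    obtain m where "m \<in> ?S" "ennreal m < ennreal (N + inverse (real (Suc k)))"
      using less unfolding lux_norm_def INF_less_iff by blast
    then show ?thesis by (auto simp: ennreal_less_iff simp del: ennreal_plus)
  qed
  then obtain L where L: "\<And>k. L k > 0" "\<And>k. orlicz_int A \<Omega> f (L k) \<le> 1"
    "\<And>k::nat. L k < N + inverse (real (Suc k))"
    by (metis (no_types, lifting) mem_Collect_eq)
  have N_le: "N \<le> L k" for k
  proof -
    have "lux_norm A \<Omega> f \<le> ennreal (L k)"
      unfolding lux_norm_def using L by (intro INF_lower2[of "L k"]) auto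
    then show ?thesis using N L(1)[of k] by (simp add: ennreal_le_iff)
  qed
  have "L \<longlonglongrightarrow> N"
  proof (rule tendsto_sandwich[OF _ _ tendsto_const LIMSEQ_inverse_real_of_nat_add])
    show "\<forall>\<^sub>F k in sequentially. L k \<le> N + inverse (real (Suc k))"
      using L(3) by (intro always_eventually allI less_imp_le)
  qed (simp add: N_le)
  then show ?thesis using that N L by blast
qed

section \<open>From open sets to arbitrary sets\<close>

theorem theorem3p6:
  fixes \<Omega> :: "(real^'n) set" and u :: "real^'n \<Rightarrow> real^'m"
    and G :: "real^'n \<Rightarrow> real^'n^'m" and A :: "real \<Rightarrow> real" and \<kappa> :: real
  assumes "CARD('m) \<ge> CARD('n)"
    and "open \<Omega>"
    and "young A" and "cond_C1 CARD('n) A" and "cond_C2 A" and "cond_C3 CARD('n) A"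
    and "\<kappa> > 0" and "kappa_prop \<kappa> A \<Omega> TYPE(real^'n \<Rightarrow> real^'m)"
    and "V1A A \<Omega> u G" and "continuous_on \<Omega> u"
    and "E \<subseteq> \<Omega>"
  shows "hcontent CARD('n) (u ` E)
     \<le> 2 * ennreal (\<kappa> ^ (CARD('n) + 1)) * lux_norm A \<Omega> (\<lambda>x. norm (G x)) ^ CARD('n)
        * Phi CARD('n) (B_fun CARD('n) A)
            (louter E * ennreal (real CARD('n) powr (real CARD('n) / 2) / \<kappa>))"
proof -
  let ?n = "CARD('n)" and ?f = "\<lambda>x. norm (G x)"
  define c where "c = real ?n powr (real ?n / 2) / \<kappa>"
  define \<phi> where "\<phi> = (\<lambda>s. e2ennreal (inv_fun (B_fun ?n A) s) ^ ?n)"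
  have c: "c > 0" using \<open>\<kappa> > 0\<close> by (simp add: c_def)
  have \<phi>_fin: "\<phi> s < \<infinity>" if "s > 0" for s
  proof -
    have "inv_fun (B_fun ?n A) s < \<infinity>"
      using assms that by (intro inv_fun_B_finite) (auto simp: Suc_le_eq)
    then have "e2ennreal (inv_fun (B_fun ?n A) s) < \<infinity>"
      by (cases "inv_fun (B_fun ?n A) s") (auto simp: e2ennreal_neg)
    then show ?thesis by (simp add: \<phi>_def power_less_top_ennreal)
  qed
  have \<Omega>_leb: "\<Omega> \<in> sets lebesgue" using \<open>open \<Omega>\<close> by auto
  have f: "in_orlicz A \<Omega> ?f" using \<open>V1A A \<Omega> u G\<close> by (simp add: V1A_def)
  obtain N L where N: "N \<ge> 0" "lux_norm A \<Omega> ?f = ennreal N" and L: "\<And>k. L k > 0"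
    "\<And>k::nat. orlicz_int A \<Omega> ?f (L k) \<le> 1" "L \<longlonglongrightarrow> N"
    using lux_norm_approx[OF \<open>young A\<close> \<Omega>_leb f] by blast
  have L_fin: "orlicz_int A \<Omega> ?f (L k) < \<infinity>" for k
    using L(2)[of k] by (rule le_less_trans) simp
  have bound: "hcontent ?n (u ` E) \<le> ennreal (\<kappa> ^ (?n + 1) * L k ^ ?n) * \<phi> (1 / \<rho>)
        * (emeasure lebesgue U * ennreal c + orlicz_int A U ?f (L k) * ennreal \<rho>)"
    if "open U" "U \<subseteq> \<Omega>" "E \<subseteq> U" "\<rho> > 0" for U \<rho> k
    unfolding \<phi>_def c_def
    using hcontent_image_le[OF \<open>open \<Omega>\<close> \<open>young A\<close> assms(7,8,9,10) L(1) L_fin that] .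
  \<comment> \<open>If \<open>N = 0\<close>, the right side is 0 even when \<open>Phi\<close> is
    infinite, because 0 times infinity is 0 in \<open>ennreal\<close>; the content must then vanish.
    In case \<open>inf\<close> the right side is infinite.\<close>
  consider (norm0) "N = 0" | (inf) "N > 0" "louter E = \<infinity>" | (null) "louter E = 0"
    | (pos) "louter E \<noteq> 0" "louter E < \<infinity>"
    using N(1) by (metis infinity_ennreal_def less_le top.not_eq_extremum)
  then show ?thesis
  proof cases
    case norm0
    obtain Q :: "nat \<Rightarrow> _" where Q: "\<And>i. Q i = {} \<or> (\<exists>a r. r > 0 \<and> Q i = cbox a (a + r *\<^sub>R One))"
      "disjoint_family (\<lambda>i. interior (Q i))" "(\<Union>i. Q i) = \<Omega>"
      by (rule open_nonoverlapping_cubes[OF \<open>open \<Omega>\<close>]) (rule that)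
    \<comment> \<open>The argument runs cube by cube because \<Omega> may have infinite measure. On
      one cube the bound is a finite constant times \<open>L k ^ ?n\<close>, which tends to
      0.\<close>
    have "ediam (u ` Q i) ^ ?n = 0" for i
    proof (cases "Q i = {}")
      case True
      then show ?thesis by (simp add: power_0_left)
    next
      case False
      then obtain a r where ar: "r > 0" "Q i = cbox a (a + r *\<^sub>R One)" using Q(1) by blast
      then have sub: "cbox a (a + r *\<^sub>R One) \<subseteq> \<Omega>" using Q(3) by blast
      obtain p where p: "p \<ge> 0" "\<phi> 1 = ennreal p"
        using \<phi>_fin[of 1] by (cases "\<phi> 1") auto
      have "ediam (u ` Q i) ^ ?n \<le> ennreal (\<kappa> ^ (?n + 1) * L k ^ ?n * (p * (r ^ ?n * c + 1)))" for k
      proof -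
        have "ediam (u ` Q i) ^ ?n \<le> ennreal (\<kappa> ^ (?n + 1) * L k ^ ?n) * \<phi> (1 / 1)
            * (emeasure lebesgue (box a (a + r *\<^sub>R One)) * ennreal c
               + orlicz_int A (box a (a + r *\<^sub>R One)) ?f (L k) * ennreal 1)"
          unfolding \<phi>_def c_def ar(2)
          by (rule ediam_image_cube_power_le[OF \<open>young A\<close> assms(7,8,9,10) L(1) L_fin ar(1) sub]) simp
        also have "\<dots> \<le> ennreal (\<kappa> ^ (?n + 1) * L k ^ ?n) * ennreal p * (ennreal (r ^ ?n) * ennreal c + 1 * ennreal 1)"
        proof (intro mult_mono add_mono)
          show "emeasure lebesgue (box a (a + r *\<^sub>R One)) \<le> ennreal (r ^ ?n)"
            using emeasure_cube[OF ar(1), of a] by simp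
          have "box a (a + r *\<^sub>R One) \<subseteq> \<Omega>" using sub box_subset_cbox by blast
          from orlicz_int_mono[OF this] L(2)
          show "orlicz_int A (box a (a + r *\<^sub>R One)) ?f (L k) \<le> 1" by (rule order_trans)
        qed (use p in auto)
        also have "\<dots> = ennreal (\<kappa> ^ (?n + 1) * L k ^ ?n * (p * (r ^ ?n * c + 1)))"
          using p c ar(1) \<open>\<kappa> > 0\<close> L(1)[of k]
          by (simp add: mult.assoc flip: ennreal_mult ennreal_plus ennreal_1)
        finally show ?thesis .
      qed
      moreover have "(\<lambda>k. ennreal (\<kappa> ^ (?n + 1) * L k ^ ?n * (p * (r ^ ?n * c + 1))))
          \<longlonglongrightarrow> ennreal (\<kappa> ^ (?n + 1) * N ^ ?n * (p * (r ^ ?n * c + 1)))"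
        by (intro tendsto_ennrealI tendsto_intros L(3))
      ultimately have "ediam (u ` Q i) ^ ?n \<le> ennreal (\<kappa> ^ (?n + 1) * N ^ ?n * (p * (r ^ ?n * c + 1)))"
        by (intro LIMSEQ_le_const) auto
      then show ?thesis using norm0 by (simp add: power_0_left)
    qed
    moreover have "u ` E \<subseteq> (\<Union>i. u ` Q i)" using \<open>E \<subseteq> \<Omega>\<close> Q(3) by blast
    ultimately have "hcontent ?n (u ` E) \<le> 0"
      using hcontent_le[of "u ` E" "\<lambda>i. u ` Q i" ?n] by (simp add: power_0_left)
    then show ?thesis by simp
  next
    case inf
    have "lux_norm A \<Omega> ?f ^ ?n \<noteq> 0" using inf N by (simp add: ennreal_power)
    moreover have "Phi ?n (B_fun ?n A) (louter E * ennreal c) = \<infinity>"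
      using inf c by (simp add: Phi_def ennreal_top_mult)
    ultimately show ?thesis
      using \<open>\<kappa> > 0\<close> unfolding c_def by (simp add: ennreal_mult_top)
  next
    case null
    have f_meas: "?f \<in> borel_measurable (lebesgue_on \<Omega>)"
      using f by (simp add: in_orlicz_def)
    have "\<exists>T. open T \<and> E \<subseteq> T \<and> emeasure lebesgue T < ennreal (inverse (real (Suc k)))" for k :: nat
    proof -
      have "louter E < \<infinity>" using null by simp
      then obtain T where "open T" "E \<subseteq> T"
        "emeasure lebesgue T < louter E + ennreal (inverse (real (Suc k)))"
        by (rule louter_open_cover[of E "inverse (real (Suc k))"]) auto
      then show ?thesis using null by auto
    qed
    then obtain T where T: "\<And>k. open (T k)" "\<And>k. E \<subseteq> T k"
      "\<And>k::nat. emeasure lebesgue (T k) < ennreal (inverse (real (Suc k)))" by metis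
    \<comment> \<open>Intersecting the first neighbourhoods makes the sequence decreasing, so that
      continuity from above applies to the energy measure.\<close>
    define V where "V = (\<lambda>k. \<Omega> \<inter> (\<Inter>j\<le>k. T j))"
    have V: "open (V k)" "V k \<subseteq> \<Omega>" "E \<subseteq> V k" "V k \<in> sets lebesgue" for k
    proof -
      show "open (V k)" unfolding V_def using T(1) \<open>open \<Omega>\<close> by (intro open_Int open_INT) auto
      then show "V k \<in> sets lebesgue" by auto
    qed (use T(2) \<open>E \<subseteq> \<Omega>\<close> in \<open>auto simp: V_def\<close>)
    have V_dec: "decseq V" by (auto simp: V_def decseq_def)
    have V_le: "emeasure lebesgue (V k) \<le> ennreal (inverse (real (Suc k)))" for k
    proof -
      have "emeasure lebesgue (V k) \<le> emeasure lebesgue (T k)"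
        using T(1)[of k] by (intro emeasure_mono) (auto simp: V_def)
      then show ?thesis using T(3)[of k] by simp
    qed
    have lim0: "(\<lambda>k. ennreal (inverse (real (Suc k)))) \<longlonglongrightarrow> 0"
      using tendsto_ennrealI[OF LIMSEQ_inverse_real_of_nat] by simp
    have V_lim: "(\<lambda>k. emeasure lebesgue (V k)) \<longlonglongrightarrow> 0"
      by (rule tendsto_sandwich[OF _ _ tendsto_const lim0]) (simp, intro always_eventually allI V_le)
    have "emeasure lebesgue (\<Inter>k. V k) \<le> emeasure lebesgue (V k)" for k
    proof (rule emeasure_mono)
      show "(\<Inter>k. V k) \<subseteq> V k" by blast
    qed (rule V(4))
    then have "emeasure lebesgue (\<Inter>k. V k) \<le> 0"
      by (intro LIMSEQ_le_const[OF V_lim]) blast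
    then have V_null: "(\<Inter>k. V k) \<in> null_sets lebesgue"
    proof (intro null_setsI)
      show "(\<Inter>k. V k) \<in> sets lebesgue"
        by (rule sets.countable_INT) (use V(4) in blast)+
    qed simp
    \<comment> \<open>The limit is 0 at any fixed admissible scale, so \<open>L 0\<close>
      suffices.\<close>
    obtain \<mu> where \<mu>: "sets \<mu> = sets lebesgue" "absolutely_continuous lebesgue \<mu>"
      "\<And>S. S \<in> sets lebesgue \<Longrightarrow> S \<subseteq> \<Omega> \<Longrightarrow> emeasure \<mu> S = orlicz_int A S ?f (L 0)"
      by (rule orlicz_int_as_measure[OF \<open>young A\<close> \<Omega>_leb f_meas L(1)]) (rule that)
    have \<mu>V: "emeasure \<mu> (V k) = orlicz_int A (V k) ?f (L 0)" for k
      using V by (intro \<mu>(3)) auto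
    have \<mu>V_fin: "emeasure \<mu> (V k) < \<infinity>" for k
      unfolding \<mu>V using orlicz_int_mono[OF V(2)] L_fin by (rule le_less_trans)
    have "(\<lambda>k. emeasure \<mu> (V k)) \<longlonglongrightarrow> emeasure \<mu> (\<Inter>k. V k)"
    proof (rule Lim_emeasure_decseq[OF _ V_dec])
      show "range V \<subseteq> sets \<mu>" using V(4) \<mu>(1) by blast
      show "emeasure \<mu> (V k) \<noteq> \<infinity>" for k using \<mu>V_fin[of k] by simp
    qed
    moreover have "emeasure \<mu> (\<Inter>k. V k) = 0"
      using \<mu>(2) V_null unfolding absolutely_continuous_def by blast
    ultimately have \<mu>_lim: "(\<lambda>k. emeasure \<mu> (V k)) \<longlonglongrightarrow> 0" by simp
    \<comment> \<open>The choice \<rho> = c |E| would be 0 here; \<rho> = 1 works since both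
      measures of \<open>V k\<close> tend to 0 and \<phi> 1 is finite.\<close>
    have "hcontent ?n (u ` E) \<le> ennreal (\<kappa> ^ (?n + 1) * L 0 ^ ?n) * \<phi> 1
        * (ennreal c * emeasure lebesgue (V k) + emeasure \<mu> (V k))" for k
      using bound[OF V(1)[of k] V(2,3) zero_less_one, of 0] by (simp add: \<mu>V mult.commute)
    moreover have "(\<lambda>k. ennreal (\<kappa> ^ (?n + 1) * L 0 ^ ?n) * \<phi> 1
        * (ennreal c * emeasure lebesgue (V k) + emeasure \<mu> (V k)))
        \<longlonglongrightarrow> ennreal (\<kappa> ^ (?n + 1) * L 0 ^ ?n) * \<phi> 1 * (ennreal c * 0 + 0)"
    proof (rule ennreal_tendsto_cmult)
      show "ennreal (\<kappa> ^ (?n + 1) * L 0 ^ ?n) * \<phi> 1 < top"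
        using \<phi>_fin[of 1] by (simp add: ennreal_mult_less_top)
      show "(\<lambda>k. ennreal c * emeasure lebesgue (V k) + emeasure \<mu> (V k)) \<longlonglongrightarrow> ennreal c * 0 + 0"
        by (intro tendsto_add ennreal_tendsto_cmult V_lim \<mu>_lim) simp
    qed
    ultimately have "hcontent ?n (u ` E) \<le> ennreal (\<kappa> ^ (?n + 1) * L 0 ^ ?n) * \<phi> 1 * (ennreal c * 0 + 0)"
      by (intro LIMSEQ_le_const) auto
    then show ?thesis by simp
  next
    case pos
    then obtain m where m: "m > 0" "louter E = ennreal m"
      by (cases "louter E") (auto simp: less_le)
    \<comment> \<open>This is the argument of \<open>Phi\<close>. With \<rho> = r the volume term
      tends to \<open>r\<close> and the energy term is at most \<open>r\<close>, which gives the
      factor 2.\<close>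
    define r where "r = m * c"
    have r: "r > 0" using m c by (simp add: r_def)
    obtain p where p: "p \<ge> 0" "\<phi> (1 / r) = ennreal p"
      using \<phi>_fin[of "1 / r"] r by (cases "\<phi> (1 / r)") auto
    have "hcontent ?n (u ` E)
        \<le> ennreal (\<kappa> ^ (?n + 1) * L k ^ ?n * p * ((m + inverse (real (Suc k))) * c + r))" for k
    proof -
      obtain T where T: "open T" "E \<subseteq> T" "emeasure lebesgue T < louter E + ennreal (inverse (real (Suc k)))"
        by (rule louter_open_cover[OF pos(2), of "inverse (real (Suc k))"]) auto
      define U where "U = T \<inter> \<Omega>"
      have U: "open U" "U \<subseteq> \<Omega>" "E \<subseteq> U"
        using T \<open>open \<Omega>\<close> \<open>E \<subseteq> \<Omega>\<close> by (auto simp: U_def)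
      have "emeasure lebesgue U \<le> emeasure lebesgue T"
        using T(1) by (intro emeasure_mono) (auto simp: U_def)
      also have "\<dots> \<le> ennreal (m + inverse (real (Suc k)))"
        using T(3) m by (simp add: less_imp_le)
      finally have Um: "emeasure lebesgue U \<le> ennreal (m + inverse (real (Suc k)))" .
      have Ui: "orlicz_int A U ?f (L k) \<le> 1"
        using orlicz_int_mono[OF U(2)] L(2) by (rule order_trans)
      have "hcontent ?n (u ` E) \<le> ennreal (\<kappa> ^ (?n + 1) * L k ^ ?n) * \<phi> (1 / r)
          * (emeasure lebesgue U * ennreal c + orlicz_int A U ?f (L k) * ennreal r)"
        by (rule bound[OF U r])
      also have "\<dots> \<le> ennreal (\<kappa> ^ (?n + 1) * L k ^ ?n) * ennreal p
          * (ennreal (m + inverse (real (Suc k))) * ennreal c + 1 * ennreal r)"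
        unfolding p(2) by (intro mult_left_mono mult_right_mono add_mono Um Ui) auto
      also have "\<dots> = ennreal (\<kappa> ^ (?n + 1) * L k ^ ?n * p * ((m + inverse (real (Suc k))) * c + r))"
        using p c m r \<open>\<kappa> > 0\<close> L(1)[of k] by (simp flip: ennreal_mult ennreal_plus)
      finally show ?thesis .
    qed
    moreover have "(\<lambda>k. ennreal (\<kappa> ^ (?n + 1) * L k ^ ?n * p * ((m + inverse (real (Suc k))) * c + r)))
        \<longlonglongrightarrow> ennreal (\<kappa> ^ (?n + 1) * N ^ ?n * p * ((m + 0) * c + r))"
      by (intro tendsto_ennrealI tendsto_intros L(3) LIMSEQ_inverse_real_of_nat)
    ultimately have "hcontent ?n (u ` E) \<le> ennreal (\<kappa> ^ (?n + 1) * N ^ ?n * p * ((m + 0) * c + r))"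
      by (intro LIMSEQ_le_const) auto
    also have "\<dots> = ennreal (2 * \<kappa> ^ (?n + 1) * N ^ ?n * (r * p))"
      by (simp add: r_def algebra_simps)
    also have "\<dots> = 2 * ennreal (\<kappa> ^ (?n + 1)) * lux_norm A \<Omega> ?f ^ ?n * (ennreal r * ennreal p)"
      using \<open>\<kappa> > 0\<close> N r p by (simp add: ennreal_mult ennreal_power)
    also have "ennreal r * ennreal p = Phi ?n (B_fun ?n A) (ennreal r)"
      using r unfolding p(2)[symmetric] by (simp add: Phi_def \<phi>_def)
    also have "ennreal r = louter E * ennreal c"
      using m c by (simp add: r_def ennreal_mult)
    finally show ?thesis unfolding c_def .
  qed
qed

end
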